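(* For all $n\ge1$ and $0\le k\le n$, $R_{k,2n}=\binom{n}{k}^2(n!)^2$.
   Context: $\mathcal{S}_m$ denotes the set of permutations $\sigma=\sigma_1\cdots\sigma_m$ of $\{1,\dots,m\}$. $\overleftarrow{des}_E(\sigma)$ is the number of indices $i\in\{1,\dots,m-1\}$ with $\sigma_i>\sigma_{i+1}$ and $\sigma_i$ even. $R_{k,m}$ denotes the number of $\sigma\in\mathcal{S}_m$ with $\overleftarrow{des}_E(\sigma)=k$. *)

theory Defs
  imports "HOL-Combinatorics.Permutations"
begin

text \<open>A permutation \<open>\<sigma>\<^sub>1 \<dots> \<sigma>\<^sub>m\<close> of \<open>{1, \<dots>, m}\<close> is a function \<open>\<sigma>\<close> with
  \<open>\<sigma> permutes {1..m}\<close>, its \<open>i\<close>-th letter being \<open>\<sigma> i\<close>. Since \<open>permutes\<close> forces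
  \<open>\<sigma>\<close> to be the identity outside \<open>{1..m}\<close>, each permutation is counted exactly once.\<close>

definition des_E :: "nat \<Rightarrow> (nat \<Rightarrow> nat) \<Rightarrow> nat" where
  "des_E m \<sigma> = card {i \<in> {1..<m}. \<sigma> i > \<sigma> (i + 1) \<and> even (\<sigma> i)}"

definition R :: "nat \<Rightarrow> nat \<Rightarrow> nat" where
  "R k m = card {\<sigma>. \<sigma> permutes {1..m} \<and> des_E m \<sigma> = k}"

end

theory Submission
  imports Defs
begin

text \<open>Build permutations by inserting the largest letter \<open>M\<close>. An odd \<open>M\<close> destroys the descent it is
  inserted into, if that descent has an even top, and otherwise changes nothing. An even \<open>M\<close> creates
  a descent, unless it is put at the end or replaces the top of an existing one. Counting the insertion
  places of each kind gives linear recurrences for the passages from \<open>2n\<close> to \<open>2n + 1\<close> and from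
  \<open>2n + 1\<close> to \<open>2n + 2\<close>, which are solved by \<open>(n choose k)\<^sup>2 (n!)\<^sup>2\<close> and
  \<open>(n choose k) (n + 1 choose k + 1) (n + 1) (n!)\<^sup>2\<close>.\<close>

section \<open>Words, their even descents, and insertion of a letter\<close>

fun even_descents :: "nat list \<Rightarrow> nat" where
  "even_descents (x # y # xs) = of_bool (x > y \<and> even x) + even_descents (y # xs)"
| "even_descents _ = 0"

definition insert_at :: "'a \<Rightarrow> nat \<Rightarrow> 'a list \<Rightarrow> 'a list" where
  "insert_at a j xs = take j xs @ a # drop j xs"

definition perm_lists :: "nat \<Rightarrow> nat list set" where
  "perm_lists m = {xs. distinct xs \<and> set xs = {1..m}}"

text \<open>A sum of indicators rather than a cardinality, so that it can be reindexed and combined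
  with sums over insertion places.\<close>

definition even_descents_count :: "nat \<Rightarrow> nat \<Rightarrow> nat" where
  "even_descents_count k m = (\<Sum>xs\<in>perm_lists m. of_bool (even_descents xs = k))"

section \<open>Sums over the insertion places of a largest letter\<close>

lemma insert_at_0 [simp]: "insert_at a 0 xs = a # xs"
  by (simp add: insert_at_def)

lemma insert_at_Suc [simp]: "insert_at a (Suc j) (x # xs) = x # insert_at a j xs"
  by (simp add: insert_at_def)

text \<open>This bound keeps the natural-number subtractions in the place counts below from
  truncating.\<close>

lemma even_descents_Cons_le: "even_descents (x # xs) \<le> length xs"
  by (induction xs arbitrary: x) (auto simp: of_bool_def intro: le_SucI)

text \<open>Keeping \<open>x\<close> in front excludes the place before it, so the induction can
  peel off one letter at a time. An arbitrary weight \<open>f\<close> lets the contribution of the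
  first pair be absorbed as a shift of the argument.\<close>

lemma sum_insert_odd_Cons:
  assumes "odd M" and "\<forall>a\<in>set (x # xs). a < M"
  shows "(\<Sum>j\<le>length xs. f (even_descents (x # insert_at M j xs))) =
    even_descents (x # xs) * f (even_descents (x # xs) - 1) +
    (length xs + 1 - even_descents (x # xs)) * (f (even_descents (x # xs)) :: nat)"
  using assms(2)
proof (induction xs arbitrary: x f)
  case Nil
  then show ?case by simp
next
  case (Cons y ys)
  define c where "c = (of_bool (x > y \<and> even x) :: nat)"
  define d where "d = even_descents (y # ys)"
  have "d \<le> length ys" unfolding d_def by (rule even_descents_Cons_le)
  \<comment> \<open>At \<open>j = 0\<close> the odd \<open>M\<close> separates \<open>x\<close> from
    \<open>y\<close>: neither \<open>x\<close> nor \<open>M\<close> tops an even descent, and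
    \<open>d\<close> remains. All other places leave the pair \<open>x\<close>, \<open>y\<close>
    intact.\<close>
  have "(\<Sum>j\<le>length (y # ys). f (even_descents (x # insert_at M j (y # ys)))) =
      f d + (\<Sum>j\<le>length ys. f (c + even_descents (y # insert_at M j ys)))"
    using Cons.prems assms(1) by (simp add: sum.atMost_Suc_shift c_def d_def del: sum.atMost_Suc)
  also have "\<dots> = f d + (d * f (c + (d - 1)) + (length ys + 1 - d) * f (c + d))"
    using Cons.IH[of y "\<lambda>i. f (c + i)"] Cons.prems by (simp add: d_def)
  \<comment> \<open>The lone \<open>f d\<close> joins the first group if \<open>c = 1\<close> and
    the second if \<open>c = 0\<close>. At \<open>d = 0\<close> the truncated \<open>d - 1\<close>
    is harmless, having coefficient 0.\<close>
  also have "\<dots> = (c + d) * f (c + d - 1) + (length (y # ys) + 1 - (c + d)) * f (c + d)"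
    using \<open>d \<le> length ys\<close> by (cases "d = 0") (auto simp: c_def Suc_diff_le)
  finally show ?case by (simp add: c_def d_def)
qed

text \<open>The extra place in front of a nonempty word is neutral, since an odd \<open>M\<close>
  tops no even descent.\<close>

lemma sum_insert_odd:
  assumes "odd M" and "\<forall>a\<in>set xs. a < M"
  shows "(\<Sum>j\<le>length xs. f (even_descents (insert_at M j xs))) =
    even_descents xs * f (even_descents xs - 1) +
    (length xs + 1 - even_descents xs) * (f (even_descents xs) :: nat)"
proof (cases xs)
  case (Cons x ys)
  have "even_descents (x # ys) \<le> length ys" by (rule even_descents_Cons_le)
  with sum_insert_odd_Cons[of M x ys f] assms Cons show ?thesis
    by (simp add: sum.atMost_Suc_shift Suc_diff_le del: sum.atMost_Suc)
qed simp

lemma sum_insert_even_Cons: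
  assumes "even M" and "\<forall>a\<in>set (x # xs). a < M"
  shows "(\<Sum>j\<le>length xs. f (even_descents (x # insert_at M j xs))) =
    (even_descents (x # xs) + 1) * f (even_descents (x # xs)) +
    (length xs - even_descents (x # xs)) * (f (even_descents (x # xs) + 1) :: nat)"
  using assms(2)
proof (induction xs arbitrary: x f)
  case Nil
  then show ?case by simp
next
  case (Cons y ys)
  define c where "c = (of_bool (x > y \<and> even x) :: nat)"
  define d where "d = even_descents (y # ys)"
  have "d \<le> length ys" unfolding d_def by (rule even_descents_Cons_le)
  have "(\<Sum>j\<le>length (y # ys). f (even_descents (x # insert_at M j (y # ys)))) =
      f (d + 1) + (\<Sum>j\<le>length ys. f (c + even_descents (y # insert_at M j ys)))"
    using Cons.prems assms(1) by (simp add: sum.atMost_Suc_shift c_def d_def del: sum.atMost_Suc)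
  also have "\<dots> = f (d + 1) + ((d + 1) * f (c + d) + (length ys - d) * f (c + d + 1))"
    using Cons.IH[of y "\<lambda>i. f (c + i)"] Cons.prems by (simp add: d_def)
  \<comment> \<open>The place between \<open>x\<close> and \<open>y\<close> makes \<open>M\<close> a
    new even top: it replaces \<open>x\<close> if \<open>c = 1\<close> and adds a descent if
    \<open>c = 0\<close>.\<close>
  also have "\<dots> = (c + d + 1) * f (c + d) + (length (y # ys) - (c + d)) * f (c + d + 1)"
    using \<open>d \<le> length ys\<close> by (auto simp: c_def Suc_diff_le)
  finally show ?case by (simp add: c_def d_def)
qed

text \<open>In front of a nonempty word the even \<open>M\<close> creates a descent, so this place
  joins the second group.\<close>

lemma sum_insert_even:
  assumes "even M" and "\<forall>a\<in>set xs. a < M"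
  shows "(\<Sum>j\<le>length xs. f (even_descents (insert_at M j xs))) =
    (even_descents xs + 1) * f (even_descents xs) +
    (length xs - even_descents xs) * (f (even_descents xs + 1) :: nat)"
proof (cases xs)
  case (Cons x ys)
  have "even_descents (x # ys) \<le> length ys" by (rule even_descents_Cons_le)
  with sum_insert_even_Cons[of M x ys f] assms Cons show ?thesis
    by (simp add: sum.atMost_Suc_shift Suc_diff_le del: sum.atMost_Suc)
qed simp

section \<open>Insertion of the largest letter as a bijection\<close>

lemma length_perm_lists: "xs \<in> perm_lists m \<Longrightarrow> length xs = m"
  by (metis (mono_tags, lifting) perm_lists_def mem_Collect_eq distinct_card card_atLeastAtMost
      diff_Suc_1)

lemma insert_at_perm_lists:
  assumes "xs \<in> perm_lists m"
  shows "insert_at (Suc m) j xs \<in> perm_lists (Suc m)"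
proof -
  have xs: "distinct xs" "set xs = {1..m}"
    using assms by (auto simp: perm_lists_def)
  have un: "set (take j xs) \<union> set (drop j xs) = {1..m}"
    using xs(2) by (metis append_take_drop_id set_append)
  have "Suc m \<notin> set (take j xs) \<union> set (drop j xs)"
    unfolding un by simp
  hence "Suc m \<notin> set (take j xs)" "Suc m \<notin> set (drop j xs)" by simp_all
  moreover have "set (insert_at (Suc m) j xs) = insert (Suc m) (set (take j xs) \<union> set (drop j xs))"
    by (auto simp: insert_at_def)
  moreover have "set (take j xs) \<inter> set (drop j xs) = {}"
    using xs(1) by (simp add: set_take_disj_set_drop_if_distinct)
  ultimately show ?thesis
    unfolding perm_lists_def un using xs(1) by (simp add: insert_at_def atLeastAtMostSuc_conv)
qed

text \<open>The inverse deletes \<open>Suc m\<close> and recovers its position as the length of the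
  prefix before it.\<close>

lemma bij_betw_insert_at:
  "bij_betw (\<lambda>(xs, j). insert_at (Suc m) j xs) (perm_lists m \<times> {..m}) (perm_lists (Suc m))"
proof (rule bij_betw_byWitness[where f' =
      "\<lambda>ys. (remove1 (Suc m) ys, length (takeWhile (\<lambda>y. y \<noteq> Suc m) ys))"])
  show "\<forall>p\<in>perm_lists m \<times> {..m}.
    (\<lambda>ys. (remove1 (Suc m) ys, length (takeWhile (\<lambda>y. y \<noteq> Suc m) ys)))
      ((\<lambda>(xs, j). insert_at (Suc m) j xs) p) = p"
  proof
    fix p assume "p \<in> perm_lists m \<times> {..m}"
    then obtain xs j where p: "p = (xs, j)" and xs: "xs \<in> perm_lists m" and "j \<le> m"
      by auto
    have "Suc m \<notin> set xs" using xs by (auto simp: perm_lists_def)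
    hence notin: "Suc m \<notin> set (take j xs)" by (meson in_set_takeD)
    have "takeWhile (\<lambda>y. y \<noteq> Suc m) (take j xs @ Suc m # drop j xs) = take j xs"
      using notin by (subst takeWhile_append2) auto
    \<comment> \<open>The bound on \<open>j\<close> gives \<open>take j xs\<close> length exactly
      \<open>j\<close>.\<close>
    with notin \<open>j \<le> m\<close> length_perm_lists[OF xs]
    show "(\<lambda>ys. (remove1 (Suc m) ys, length (takeWhile (\<lambda>y. y \<noteq> Suc m) ys)))
        ((\<lambda>(xs, j). insert_at (Suc m) j xs) p) = p"
      by (simp add: p insert_at_def remove1_append)
  qed
  have split: "\<exists>us vs. ys = us @ Suc m # vs \<and> Suc m \<notin> set us" if "ys \<in> perm_lists (Suc m)" for ys
    using that by (intro split_list_first) (auto simp: perm_lists_def)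
  show "\<forall>ys\<in>perm_lists (Suc m). (\<lambda>(xs, j). insert_at (Suc m) j xs)
      (remove1 (Suc m) ys, length (takeWhile (\<lambda>y. y \<noteq> Suc m) ys)) = ys"
  proof
    fix ys assume "ys \<in> perm_lists (Suc m)"
    then obtain us vs where ys: "ys = us @ Suc m # vs" "Suc m \<notin> set us"
      using split by blast
    have "takeWhile (\<lambda>y. y \<noteq> Suc m) ys = us"
      using ys by (simp, subst takeWhile_append2) auto
    thus "(\<lambda>(xs, j). insert_at (Suc m) j xs)
        (remove1 (Suc m) ys, length (takeWhile (\<lambda>y. y \<noteq> Suc m) ys)) = ys"
      using ys by (simp add: insert_at_def remove1_append)
  qed
  show "(\<lambda>(xs, j). insert_at (Suc m) j xs) ` (perm_lists m \<times> {..m}) \<subseteq> perm_lists (Suc m)"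
    by (auto intro: insert_at_perm_lists)
  show "(\<lambda>ys. (remove1 (Suc m) ys, length (takeWhile (\<lambda>y. y \<noteq> Suc m) ys))) ` perm_lists (Suc m)
      \<subseteq> perm_lists m \<times> {..m}"
  proof safe
    fix ys assume ys: "ys \<in> perm_lists (Suc m)"
    show "remove1 (Suc m) ys \<in> perm_lists m"
      using ys by (simp add: perm_lists_def atLeastAtMostSuc_conv)
    obtain us vs where us: "ys = us @ Suc m # vs" "Suc m \<notin> set us"
      using split[OF ys] by blast
    have "takeWhile (\<lambda>y. y \<noteq> Suc m) ys = us"
      using us by (simp, subst takeWhile_append2) auto
    thus "length (takeWhile (\<lambda>y. y \<noteq> Suc m) ys) \<le> m"
      using us length_perm_lists[OF ys] by simp
  qed
qed

section \<open>Recurrences for the counts\<close>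

lemma even_descents_count_Suc:
  "even_descents_count k (Suc m) =
    (\<Sum>xs\<in>perm_lists m. \<Sum>j\<le>length xs. of_bool (even_descents (insert_at (Suc m) j xs) = k))"
proof -
  have "even_descents_count k (Suc m) = (\<Sum>(xs, j)\<in>perm_lists m \<times> {..m}.
      of_bool (even_descents (insert_at (Suc m) j xs) = k))"
    unfolding even_descents_count_def
    by (subst sum.reindex_bij_betw[OF bij_betw_insert_at, symmetric]) (simp add: case_prod_unfold)
  thus ?thesis
    by (simp add: sum.cartesian_product[symmetric] length_perm_lists cong: sum.cong)
qed

text \<open>The new letter \<open>Suc m\<close> is odd: \<open>k + 1\<close> places destroy one of
  \<open>k + 1\<close> descents, and \<open>m + 1 - k\<close> places preserve \<open>k\<close>
  descents.\<close>

lemma even_descents_count_Suc_even: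
  assumes "even m"
  shows "even_descents_count k (Suc m) =
    (k + 1) * even_descents_count (k + 1) m + (m + 1 - k) * even_descents_count k m"
proof -
  have "(\<Sum>j\<le>length xs. of_bool (even_descents (insert_at (Suc m) j xs) = k)) =
      (k + 1) * of_bool (even_descents xs = k + 1) + (m + 1 - k) * (of_bool (even_descents xs = k) :: nat)"
    if "xs \<in> perm_lists m" for xs
  proof -
    have "\<forall>a\<in>set xs. a < Suc m" using that by (auto simp: perm_lists_def)
    from sum_insert_odd[OF _ this, of "\<lambda>i. of_bool (i = k)"] assms length_perm_lists[OF that]
    show ?thesis by (cases "even_descents xs") (auto simp: of_bool_def)
  qed
  thus ?thesis
    unfolding even_descents_count_Suc
    by (simp add: even_descents_count_def sum.distrib sum_distrib_left del: One_nat_def)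
qed

text \<open>Now \<open>Suc m\<close> is even, and a word with \<open>k - 1\<close> descents has
  \<open>m - (k - 1)\<close> places that create one. The case \<open>k = 0\<close> is split off
  because there \<open>k - 1\<close> would truncate to 0.\<close>

lemma even_descents_count_Suc_odd:
  assumes "odd m"
  shows "even_descents_count k (Suc m) = (k + 1) * even_descents_count k m +
    (if k = 0 then 0 else (m + 1 - k) * even_descents_count (k - 1) m)"
proof -
  have "(\<Sum>j\<le>length xs. of_bool (even_descents (insert_at (Suc m) j xs) = k)) =
      (k + 1) * of_bool (even_descents xs = k) +
      (if k = 0 then 0 else (m + 1 - k) * (of_bool (even_descents xs = k - 1) :: nat))"
    if "xs \<in> perm_lists m" for xs
  proof -
    have "\<forall>a\<in>set xs. a < Suc m" using that by (auto simp: perm_lists_def)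
    from sum_insert_even[OF _ this, of "\<lambda>i. of_bool (i = k)"] assms length_perm_lists[OF that]
    show ?thesis by (cases k) (auto simp: of_bool_def)
  qed
  thus ?thesis
    unfolding even_descents_count_Suc
    by (simp add: even_descents_count_def sum.distrib sum_distrib_left del: One_nat_def)
qed

section \<open>Binomial identities that solve the recurrences\<close>

lemma binomial_absorb_diff: "(k + 1) * (n choose (k + 1)) = (n - k) * (n choose k)"
  \<comment> \<open>Both sides equal \<open>n * ((n - 1) choose k)\<close>.\<close>
  by (metis Suc_eq_plus1 binomial_absorb_comp binomial_absorption)

text \<open>The step from \<open>2 * n\<close> to \<open>2 * n + 1\<close> without its common factor
  \<open>(fact n)\<^sup>2\<close>. Writing \<open>n = k + r\<close> removes subtraction, and
  absorption relates the neighbouring coefficients.\<close>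

lemma binomial_step_odd:
  "(k + 1) * (n choose (k + 1))\<^sup>2 + (2 * n + 1 - k) * (n choose k)\<^sup>2 =
    (n + 1) * (n choose k) * ((n + 1) choose (k + 1))"
proof (cases "k \<le> n")
  case True
  then obtain r where n: "n = k + r" by (auto simp: le_iff_add)
  define a b where "a = n choose k" and "b = n choose (k + 1)"
  have "(k + 1) * b = r * a"
    using binomial_absorb_diff[of k n] n by (simp add: a_def b_def)
  moreover have "(n + 1) choose (k + 1) = a + b"
    by (simp add: a_def b_def)
  moreover have "2 * n + 1 - k = k + 1 + 2 * r" using n by simp
  moreover have "(k + 1) * b\<^sup>2 + (k + 1 + 2 * r) * a\<^sup>2 = (k + r + 1) * a * (a + b)"
    if "(k + 1) * b = r * a"
  proof -
    have "(k + 1) * b\<^sup>2 = r * a * b"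
      using that by (simp add: power2_eq_square flip: mult.assoc)
    moreover have "(k + 1) * (a * b) = r * a\<^sup>2"
      using that by (metis mult.assoc mult.commute power2_eq_square)
    ultimately show ?thesis by (simp add: algebra_simps power2_eq_square)
  qed
  ultimately show ?thesis using n by (simp add: a_def b_def)
qed (simp add: binomial_eq_0)

text \<open>The step to \<open>2 * n + 2\<close> at index \<open>k + 1\<close>, without its common
  factor \<open>(n + 1) * (fact n)\<^sup>2\<close>.\<close>

lemma binomial_step_even:
  "(k + 2) * ((n choose (k + 1)) * ((n + 1) choose (k + 2))) +
    (2 * n + 1 - k) * ((n choose k) * ((n + 1) choose (k + 1))) =
    (n + 1) * ((n + 1) choose (k + 1))\<^sup>2"
proof (cases "k \<le> n")
  case True
  then obtain r where n: "n = k + r" by (auto simp: le_iff_add)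
  define a b c where "a = n choose k" and "b = n choose (k + 1)" and "c = (n + 1) choose (k + 2)"
  have ab: "(k + 1) * b = r * a"
    using binomial_absorb_diff[of k n] n by (simp add: a_def b_def)
  have sum: "(n + 1) choose (k + 1) = a + b"
    by (simp add: a_def b_def)
  have c: "(k + 2) * c = r * (a + b)"
    using binomial_absorb_diff[of "k + 1" "n + 1"] n sum by (simp add: c_def)
  have "(k + 2) * (b * c) + (k + 1 + 2 * r) * (a * (a + b)) = (k + r + 1) * (a + b)\<^sup>2"
  proof -
    have "(k + 2) * (b * c) = b * (r * (a + b))" using c by (metis mult.left_commute)
    \<comment> \<open>Multiplying the absorption relation by \<open>b\<close> and by
      \<open>a\<close> matches the quadratic terms on the two sides.\<close>
    moreover have "(k + 1) * b * b = r * a * b" "(k + 1) * b * a = r * a * a" using ab by simp_all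
    ultimately show ?thesis by (simp add: algebra_simps power2_eq_square)
  qed
  moreover have "2 * n + 1 - k = k + 1 + 2 * r" using n by simp
  ultimately show ?thesis using n sum by (simp add: a_def b_def c_def)
qed (simp add: binomial_eq_0)

section \<open>Closed form for words of even length\<close>

lemma even_descents_count_double:
  "even_descents_count k (2 * n) = (n choose k)\<^sup>2 * (fact n)\<^sup>2"
proof (induction n arbitrary: k)
  case 0
  have "perm_lists 0 = {[]}" by (auto simp: perm_lists_def)
  then show ?case by (cases k) (auto simp: even_descents_count_def)
next
  case (Suc n)
  \<comment> \<open>The odd-length formula is needed for every index, since the next step uses it at
    both \<open>i\<close> and \<open>i + 1\<close>.\<close>
  have odd: "even_descents_count k (Suc (2 * n)) =
      (n choose k) * ((n + 1) choose (k + 1)) * (n + 1) * (fact n)\<^sup>2" for k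
  proof -
    have "even_descents_count k (Suc (2 * n)) =
        ((k + 1) * (n choose (k + 1))\<^sup>2 + (2 * n + 1 - k) * (n choose k)\<^sup>2) * (fact n)\<^sup>2"
      by (simp only: even_descents_count_Suc_even[of "2 * n"] even_mult_iff even_numeral simp_thms
          Suc.IH distrib_right mult.assoc)
    thus ?thesis unfolding binomial_step_odd by (simp only: mult_ac)
  qed
  show ?case
  proof (cases k)
    case 0
    have "even_descents_count 0 (2 * Suc n) = even_descents_count 0 (Suc (2 * n))"
      using even_descents_count_Suc_odd[of "Suc (2 * n)" 0] by simp
    then show ?thesis using 0 odd[of 0] by (simp add: power2_eq_square algebra_simps)
  next
    case (Suc i)
    have "even_descents_count (i + 1) (2 * Suc n) =
        (i + 2) * even_descents_count (i + 1) (Suc (2 * n)) +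
        (2 * n + 1 - i) * even_descents_count i (Suc (2 * n))"
      using even_descents_count_Suc_odd[of "Suc (2 * n)" "i + 1"] by simp
    also have "\<dots> = ((i + 2) * ((n choose (i + 1)) * ((n + 1) choose (i + 2))) +
        (2 * n + 1 - i) * ((n choose i) * ((n + 1) choose (i + 1)))) * (n + 1) * (fact n)\<^sup>2"
      by (simp only: odd distrib_right mult.assoc add.assoc one_add_one)
    \<comment> \<open>The identity supplies a second factor \<open>n + 1\<close>, completing
      \<open>(fact (n + 1))\<^sup>2\<close>.\<close>
    also have "\<dots> = ((n + 1) choose (i + 1))\<^sup>2 * (fact (n + 1))\<^sup>2"
      by (simp only: binomial_step_even) (simp add: power2_eq_square algebra_simps)
    finally show ?thesis using Suc by simp
  qed
qed

section \<open>One-line notation: from words back to permutations\<close>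

lemma even_descents_map_upt:
  "even_descents (map \<sigma> [a..<Suc (a + l)]) =
    card {i \<in> {a..<a + l}. \<sigma> i > \<sigma> (i + 1) \<and> even (\<sigma> i)}"
\<comment> \<open>A free starting point \<open>a\<close> lets the induction remove the left end of
  the interval.\<close>
proof (induction l arbitrary: a)
  case 0
  then show ?case by simp
next
  case (Suc l)
  let ?P = "\<lambda>i. \<sigma> i > \<sigma> (i + 1) \<and> even (\<sigma> i)"
  have "[a..<Suc (a + Suc l)] = a # [Suc a..<Suc (Suc a + l)]"
    by (simp add: upt_rec)
  \<comment> \<open>Exposing a second entry makes the recursive equation of
    \<open>even_descents\<close> applicable.\<close>
  moreover have "[Suc a..<Suc (Suc a + l)] = Suc a # [Suc (Suc a)..<Suc (Suc a + l)]"
    by (simp add: upt_rec)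
  ultimately have "even_descents (map \<sigma> [a..<Suc (a + Suc l)]) =
      of_bool (?P a) + even_descents (map \<sigma> [Suc a..<Suc (Suc a + l)])"
    by (simp del: upt_Suc)
  also have "\<dots> = of_bool (?P a) + card {i \<in> {Suc a..<Suc a + l}. ?P i}"
    by (simp only: Suc.IH)
  also have "\<dots> = card {i \<in> {a..<a + Suc l}. ?P i}"
  proof -
    have split: "{i \<in> {a..<a + Suc l}. ?P i} =
        (if ?P a then {a} else {}) \<union> {i \<in> {Suc a..<Suc a + l}. ?P i}"
      by (auto simp: le_less Suc_le_eq)
    show ?thesis unfolding split by (subst card_Un_disjoint) auto
  qed
  finally show ?case .
qed

lemma des_E_eq_even_descents: "des_E m \<sigma> = even_descents (map \<sigma> [1..<Suc m])"
proof (cases m)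
  case (Suc l)
  then show ?thesis
    using even_descents_map_upt[of \<sigma> 1 l] by (simp add: des_E_def del: upt_Suc)
qed (simp add: des_E_def)

lemma bij_betw_map_perm_lists:
  "bij_betw (\<lambda>\<sigma>. map \<sigma> [1..<Suc m]) {\<sigma>. \<sigma> permutes {1..m}} (perm_lists m)"
  unfolding bij_betw_def
proof
  show "inj_on (\<lambda>\<sigma>. map \<sigma> [1..<Suc m]) {\<sigma>. \<sigma> permutes {1..m}}"
  proof (rule inj_onI)
    fix \<sigma> \<tau> :: "nat \<Rightarrow> nat"
    assume "\<sigma> \<in> {\<sigma>. \<sigma> permutes {1..m}}" "\<tau> \<in> {\<sigma>. \<sigma> permutes {1..m}}"
      and eq: "map \<sigma> [1..<Suc m] = map \<tau> [1..<Suc m]"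
    hence perm: "\<sigma> permutes {1..m}" "\<tau> permutes {1..m}" by simp_all
    show "\<sigma> = \<tau>"
    proof
      fix i
      show "\<sigma> i = \<tau> i"
      proof (cases "i \<in> {1..m}")
        case True
        then show ?thesis using eq by (auto simp del: upt_Suc)
      qed (simp add: perm[THEN permutes_not_in])
    qed
  qed
  show "(\<lambda>\<sigma>. map \<sigma> [1..<Suc m]) ` {\<sigma>. \<sigma> permutes {1..m}} = perm_lists m"
  proof safe
    fix \<sigma> assume \<sigma>: "\<sigma> permutes {1..m}"
    have "set [1..<Suc m] = {1..m}" by auto
    with \<sigma> show "map \<sigma> [1..<Suc m] \<in> perm_lists m"
      by (simp add: perm_lists_def distinct_map permutes_inj_on permutes_image del: upt_Suc)
  next
    fix xs assume xs: "xs \<in> perm_lists m"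
    \<comment> \<open>List positions start at 0, hence \<open>i - 1\<close>; the identity outside
      \<open>{1..m}\<close> is what \<open>permutes\<close> demands.\<close>
    define \<sigma> where "\<sigma> i = (if i \<in> {1..m} then xs ! (i - 1) else i)" for i
    have len: "length xs = m" using xs by (rule length_perm_lists)
    have map: "map \<sigma> [1..<Suc m] = xs"
      by (rule nth_equalityI) (auto simp: len \<sigma>_def simp del: upt_Suc)
    have set: "set [1..<Suc m] = {1..m}" by auto
    have "\<sigma> permutes {1..m}"
    proof (rule bij_imp_permutes)
      have "distinct (map \<sigma> [1..<Suc m])" "set (map \<sigma> [1..<Suc m]) = {1..m}"
        using xs map by (simp_all add: perm_lists_def)
      thus "bij_betw \<sigma> {1..m} {1..m}"
        unfolding bij_betw_def distinct_map set_map set by blast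
    qed (auto simp: \<sigma>_def)
    with map show "xs \<in> (\<lambda>\<sigma>. map \<sigma> [1..<Suc m]) ` {\<sigma>. \<sigma> permutes {1..m}}"
      by (metis (mono_tags, lifting) imageI mem_Collect_eq)
  qed
qed

lemma R_eq_even_descents_count: "R k m = even_descents_count k m"
proof -
  have "even_descents_count k m =
      (\<Sum>\<sigma> | \<sigma> permutes {1..m}. of_bool (des_E m \<sigma> = k))"
    unfolding even_descents_count_def des_E_eq_even_descents
    by (rule sum.reindex_bij_betw[OF bij_betw_map_perm_lists, symmetric])
  also have "\<dots> = R k m"
    by (simp add: R_def finite_permutations Int_def of_bool_def sum.If_cases)
  finally show ?thesis by simp
qed

theorem theorem3p4:
  fixes n k :: nat
  assumes "n \<ge> 1" and "k \<le> n"
  shows "R k (2 * n) = (n choose k)\<^sup>2 * (fact n)\<^sup>2"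
  by (simp add: R_eq_even_descents_count even_descents_count_double)

end
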